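(* Let $G$ be any group. There is a torsion-free subgroup $\mathcal{S}$ of $\mathcal{Z}(\mathcal{U}(\mathbb{Z}[G]))$ consisting of symmetric central units such that the following (i) and (ii) hold, and moreover (iii) holds: (i) There is an exact sequence of groups $$1\rightarrow \pm\mathcal{Z}(G)\rightarrow \mathcal{Z}(\mathcal{U}(\mathbb{Z}[G]))\rightarrow \mathcal{S}\rightarrow 1,$$ where the map $\pm\mathcal{Z}(G)\to\mathcal{Z}(\mathcal{U}(\mathbb{Z}[G]))$ is the inclusion. (ii) If $u\in\mathcal{Z}(\mathcal{U}(\mathbb{Z}[G]))$, then there exists $g\in\mathcal{Z}(G)$ such that $u=gu^{\ast}$. Furthermore, $u^2\in\mathcal{Z}(G)\mathcal{S}$. (iii) If the symmetric central units of $\mathbb{Z}[G]$ are trivial, then so are all central units, i.e. $G$ is a cut-group.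
   Context: For a group $G$ (possibly infinite), $\mathcal{U}(\mathbb{Z}[G])$ is the group of units of the integral group ring $\mathbb{Z}[G]$ and $\mathcal{Z}(\cdot)$ denotes the center of a group. For $u=\sum u_g g\in\mathbb{Z}[G]$, $u^{\ast}=\sum u_g g^{-1}$; $u$ is symmetric if $u=u^{\ast}$. A central unit of $\mathbb{Z}[G]$ is trivial if it lies in $\pm\mathcal{Z}(G)$; $G$ is a cut-group if $\mathcal{Z}(\mathcal{U}(\mathbb{Z}[G]))=\pm\mathcal{Z}(G)$. *)

theory Defs
  imports "HOL-Algebra.Ring" "HOL-Algebra.Free_Abelian_Groups" "HOL-Algebra.Exact_Sequence"
begin

definition center :: "('a, 'b) monoid_scheme \<Rightarrow> 'a set"
  where "center G = {z \<in> carrier G. \<forall>g\<in>carrier G. z \<otimes>\<^bsub>G\<^esub> g = g \<otimes>\<^bsub>G\<^esub> z}"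

definition torsion_free :: "('a, 'b) monoid_scheme \<Rightarrow> bool"
  where "torsion_free G \<longleftrightarrow>
    (\<forall>x\<in>carrier G. \<forall>n::nat. n > 0 \<and> x [^]\<^bsub>G\<^esub> n = \<one>\<^bsub>G\<^esub> \<longrightarrow> x = \<one>\<^bsub>G\<^esub>)"

text \<open>
  The underlying additive group of $\mathbb{Z}[G]$ is the library's free Abelian group on
  \<open>carrier G\<close>. The group element \<open>g\<close>, seen in $\mathbb{Z}[G]$, is \<open>frag_of g\<close>, and
  \<open>frag_extend f u\<close> is $\sum_g u_g f(g)$; so the product below is $\sum_{g,h} u_g v_h\, gh$.
\<close>

definition group_ring :: "('a, 'b) monoid_scheme \<Rightarrow> ('a \<Rightarrow>\<^sub>0 int) ring"
  where "group_ring G =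
    \<lparr>carrier = carrier (free_Abelian_group (carrier G)),
     monoid.mult = (\<lambda>u v. frag_extend (\<lambda>g. frag_extend (\<lambda>h. frag_of (g \<otimes>\<^bsub>G\<^esub> h)) v) u),
     monoid.one = frag_of \<one>\<^bsub>G\<^esub>,
     ring.zero = 0,
     ring.add = (+)\<rparr>"

definition star :: "('a, 'b) monoid_scheme \<Rightarrow> ('a \<Rightarrow>\<^sub>0 int) \<Rightarrow> ('a \<Rightarrow>\<^sub>0 int)"
  where "star G u = frag_extend (\<lambda>g. frag_of (inv\<^bsub>G\<^esub> g)) u"

definition symmetric :: "('a, 'b) monoid_scheme \<Rightarrow> ('a \<Rightarrow>\<^sub>0 int) \<Rightarrow> bool"
  where "symmetric G u \<longleftrightarrow> u = star G u"

definition central_units :: "('a, 'b) monoid_scheme \<Rightarrow> ('a \<Rightarrow>\<^sub>0 int) monoid"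
  where "central_units G =
    (units_of (group_ring G))\<lparr>carrier := center (units_of (group_ring G))\<rparr>"

text \<open>The set $\pm\mathcal{Z}(G)$ inside $\mathbb{Z}[G]$.\<close>

definition trivial_central_units :: "('a, 'b) monoid_scheme \<Rightarrow> ('a \<Rightarrow>\<^sub>0 int) set"
  where "trivial_central_units G = frag_of ` center G \<union> (\<lambda>g. - frag_of g) ` center G"

definition cut_group :: "('a, 'b) monoid_scheme \<Rightarrow> bool"
  where "cut_group G \<longleftrightarrow>
    group G \<and> center (units_of (group_ring G)) = trivial_central_units G"

lemma group_ring_simps [simp]:
  "u \<in> carrier (group_ring G) \<longleftrightarrow> Poly_Mapping.keys u \<subseteq> carrier G"
  "u \<otimes>\<^bsub>group_ring G\<^esub> v = frag_extend (\<lambda>g. frag_extend (\<lambda>h. frag_of (g \<otimes>\<^bsub>G\<^esub> h)) v) u"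
  "\<one>\<^bsub>group_ring G\<^esub> = frag_of \<one>\<^bsub>G\<^esub>"
  "\<zero>\<^bsub>group_ring G\<^esub> = 0"
  "u \<oplus>\<^bsub>group_ring G\<^esub> v = u + v"
  by (simp_all add: group_ring_def)

lemma frag_extend_fun_add: "frag_extend (\<lambda>x. f x + g x) c = frag_extend f c + frag_extend g c"
  by (simp add: frag_extend_def frag_cmul_distrib2 sum.distrib)

lemma frag_extend_fun_diff: "frag_extend (\<lambda>x. f x - g x) c = frag_extend f c - frag_extend g c"
  using frag_extend_fun_add[of "\<lambda>x. f x - g x" g c] by simp

lemma group_ring_mult_zero:
  "0 \<otimes>\<^bsub>group_ring G\<^esub> w = 0" "u \<otimes>\<^bsub>group_ring G\<^esub> 0 = 0"
  by (simp_all add: frag_extend_def)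

lemma group_ring_mult_diff:
  "(u - v) \<otimes>\<^bsub>group_ring G\<^esub> w = u \<otimes>\<^bsub>group_ring G\<^esub> w - v \<otimes>\<^bsub>group_ring G\<^esub> w"
  "u \<otimes>\<^bsub>group_ring G\<^esub> (v - w) = u \<otimes>\<^bsub>group_ring G\<^esub> v - u \<otimes>\<^bsub>group_ring G\<^esub> w"
  by (simp_all add: frag_extend_diff frag_extend_fun_diff)

lemma group_ring_mult_frag_of:
  "frag_of g \<otimes>\<^bsub>group_ring G\<^esub> frag_of h = frag_of (g \<otimes>\<^bsub>G\<^esub> h)"
  by simp

lemmas group_ring_mult_simps =
  group_ring_mult_zero group_ring_mult_diff group_ring_mult_frag_of

lemma keys_group_ring_mult:
  assumes "group G" "Poly_Mapping.keys u \<subseteq> carrier G" "Poly_Mapping.keys v \<subseteq> carrier G"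
  shows "Poly_Mapping.keys (u \<otimes>\<^bsub>group_ring G\<^esub> v) \<subseteq> carrier G"
proof -
  interpret group G by fact
  show ?thesis
    using assms(2,3)
    by (fastforce dest!: subsetD[OF keys_frag_extend])
qed

lemma group_ring_mult_assoc:
  assumes "group G" and u: "Poly_Mapping.keys u \<subseteq> carrier G"
    and v: "Poly_Mapping.keys v \<subseteq> carrier G" and w: "Poly_Mapping.keys w \<subseteq> carrier G"
  shows "(u \<otimes>\<^bsub>group_ring G\<^esub> v) \<otimes>\<^bsub>group_ring G\<^esub> w = u \<otimes>\<^bsub>group_ring G\<^esub> (v \<otimes>\<^bsub>group_ring G\<^esub> w)"
proof -
  interpret group G by fact
  note [simp del] = group_ring_simps(2)
  note [simp] = group_ring_mult_simps
  have 1: "(frag_of g \<otimes>\<^bsub>group_ring G\<^esub> frag_of h) \<otimes>\<^bsub>group_ring G\<^esub> w =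
      frag_of g \<otimes>\<^bsub>group_ring G\<^esub> (frag_of h \<otimes>\<^bsub>group_ring G\<^esub> w)"
    if "g \<in> carrier G" "h \<in> carrier G" for g h
    using w by (induction w rule: frag_induction) (use that in \<open>simp_all add: m_assoc\<close>)
  have 2: "(frag_of g \<otimes>\<^bsub>group_ring G\<^esub> v) \<otimes>\<^bsub>group_ring G\<^esub> w =
      frag_of g \<otimes>\<^bsub>group_ring G\<^esub> (v \<otimes>\<^bsub>group_ring G\<^esub> w)"
    if "g \<in> carrier G" for g
    using v
  proof (induction v rule: frag_induction)
    case (one x)
    then show ?case using 1 that by blast
  qed simp_all
  show ?thesis
    using u
  proof (induction u rule: frag_induction)
    case (one x)
    then show ?case using 2 by blast
  qed simp_all
qed

lemma ring_group_ring:
  assumes "group G"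
  shows "ring (group_ring G)"
proof -
  interpret group G by fact
  have one: "\<one>\<^bsub>group_ring G\<^esub> \<otimes>\<^bsub>group_ring G\<^esub> u = u" "u \<otimes>\<^bsub>group_ring G\<^esub> \<one>\<^bsub>group_ring G\<^esub> = u"
    if "Poly_Mapping.keys u \<subseteq> carrier G" for u
    using that by (induction u rule: frag_induction)
      (simp_all add: group_ring_mult_simps del: group_ring_simps(2))
  show ?thesis
  proof (rule ringI)
    show "abelian_group (group_ring G)"
    proof (rule abelian_groupI)
      fix x assume "x \<in> carrier (group_ring G)"
      then show "\<exists>y\<in>carrier (group_ring G). y \<oplus>\<^bsub>group_ring G\<^esub> x = \<zero>\<^bsub>group_ring G\<^esub>"
        by (intro bexI[of _ "- x"]) auto
    qed (auto simp: add_ac dest: subsetD[OF keys_add])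
    show "Group.monoid (group_ring G)"
    proof (rule monoidI)
      fix x y assume "x \<in> carrier (group_ring G)" "y \<in> carrier (group_ring G)"
      then show "x \<otimes>\<^bsub>group_ring G\<^esub> y \<in> carrier (group_ring G)"
        using keys_group_ring_mult[OF assms] by (simp del: group_ring_simps(2))
    next
      show "\<one>\<^bsub>group_ring G\<^esub> \<in> carrier (group_ring G)" by simp
    qed (use one group_ring_mult_assoc[OF assms] in
          \<open>simp_all del: group_ring_simps(2,3)\<close>)
  qed (simp_all add: frag_extend_add frag_extend_fun_add)
qed

lemma lookup_group_ring_mult:
  "Poly_Mapping.lookup (u \<otimes>\<^bsub>group_ring G\<^esub> v) k =
    (\<Sum>g\<in>Poly_Mapping.keys u. \<Sum>h\<in>Poly_Mapping.keys v.
       if k = g \<otimes>\<^bsub>G\<^esub> h then Poly_Mapping.lookup u g * Poly_Mapping.lookup v h else 0)"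
  by (simp add: frag_extend_def lookup_sum sum_distrib_left) (intro sum.cong, auto)

lemma lookup_star:
  assumes "group G" "Poly_Mapping.keys u \<subseteq> carrier G" "g \<in> carrier G"
  shows "Poly_Mapping.lookup (star G u) g = Poly_Mapping.lookup u (inv\<^bsub>G\<^esub> g)"
proof -
  interpret group G by fact
  show ?thesis
    using assms(2)
  proof (induction u rule: frag_induction)
    case (one x)
    then have "g = inv\<^bsub>G\<^esub> x \<longleftrightarrow> inv\<^bsub>G\<^esub> g = x"
      using assms(3) by auto
    then show ?case by (simp add: star_def)
  qed (simp_all add: star_def frag_extend_diff lookup_minus)
qed

lemma subgroup_center:
  assumes "group G"
  shows "subgroup (center G) G"
proof -
  interpret group G by fact
  show ?thesis
  proof (rule subgroupI)
    have "\<one>\<^bsub>G\<^esub> \<in> center G" by (simp add: center_def)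
    then show "center G \<noteq> {}" by blast
  next
    fix a assume a: "a \<in> center G"
    then have [simp]: "a \<in> carrier G" by (simp add: center_def)
    have "inv\<^bsub>G\<^esub> a \<otimes>\<^bsub>G\<^esub> g = g \<otimes>\<^bsub>G\<^esub> inv\<^bsub>G\<^esub> a" if [simp]: "g \<in> carrier G" for g
    proof -
      have "inv\<^bsub>G\<^esub> a \<otimes>\<^bsub>G\<^esub> g = inv\<^bsub>G\<^esub> a \<otimes>\<^bsub>G\<^esub> (g \<otimes>\<^bsub>G\<^esub> a) \<otimes>\<^bsub>G\<^esub> inv\<^bsub>G\<^esub> a"
        by (simp add: m_assoc)
      also have "g \<otimes>\<^bsub>G\<^esub> a = a \<otimes>\<^bsub>G\<^esub> g"
        using a that unfolding center_def by force
      also have "inv\<^bsub>G\<^esub> a \<otimes>\<^bsub>G\<^esub> (a \<otimes>\<^bsub>G\<^esub> g) \<otimes>\<^bsub>G\<^esub> inv\<^bsub>G\<^esub> a = g \<otimes>\<^bsub>G\<^esub> inv\<^bsub>G\<^esub> a"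
        by (simp flip: m_assoc)
      finally show ?thesis .
    qed
    then show "inv\<^bsub>G\<^esub> a \<in> center G" by (simp add: center_def)
  next
    fix a b assume ab: "a \<in> center G" "b \<in> center G"
    then have [simp]: "a \<in> carrier G" "b \<in> carrier G" by (simp_all add: center_def)
    have "a \<otimes>\<^bsub>G\<^esub> b \<otimes>\<^bsub>G\<^esub> g = g \<otimes>\<^bsub>G\<^esub> (a \<otimes>\<^bsub>G\<^esub> b)" if [simp]: "g \<in> carrier G" for g
    proof -
      have "b \<otimes>\<^bsub>G\<^esub> g = g \<otimes>\<^bsub>G\<^esub> b"
        using ab(2) that unfolding center_def by blast
      then have "a \<otimes>\<^bsub>G\<^esub> b \<otimes>\<^bsub>G\<^esub> g = a \<otimes>\<^bsub>G\<^esub> (g \<otimes>\<^bsub>G\<^esub> b)"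
        by (simp add: m_assoc)
      also have "\<dots> = a \<otimes>\<^bsub>G\<^esub> g \<otimes>\<^bsub>G\<^esub> b" by (simp add: m_assoc)
      also have "a \<otimes>\<^bsub>G\<^esub> g = g \<otimes>\<^bsub>G\<^esub> a"
        using ab(1) that unfolding center_def by blast
      finally show ?thesis by (simp add: m_assoc)
    qed
    then show "a \<otimes>\<^bsub>G\<^esub> b \<in> center G" by (simp add: center_def)
  qed (simp add: center_def)
qed

lemma group_central_units:
  assumes "group G"
  shows "group (central_units G)"
proof -
  interpret R: ring "group_ring G" using assms by (rule ring_group_ring)
  show ?thesis
    unfolding central_units_def
    by (rule subgroup.subgroup_is_group[OF subgroup_center]) (rule R.units_group)+
qed

end

theory Submission
  imports Defs
begin

text \<open>
  On central units, \<open>u \<mapsto> u u\<^sup>*\<close> is an endomorphism with symmetric values; \<open>\<S>\<close> is its image.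
  The coefficient of \<open>u u\<^sup>*\<close> at the identity is the sum of the squares of the coefficients
  of \<open>u\<close>. As these are integers, \<open>u u\<^sup>* = 1\<close> forces \<open>u\<close> to be trivial, so the kernel is
  \<open>\<plusminus>Z(G)\<close>. For every central unit \<open>u\<close>, the unit \<open>u (u\<^sup>*)\<^sup>-\<^sup>1\<close> lies in this kernel, hence
  equals \<open>\<plusminus>g\<close>, and the augmentation excludes the minus sign; then \<open>u\<^sup>2 = g u u\<^sup>*\<close>.
\<close>

declare group_ring_simps(1-5) [simp del]

section \<open>Integer coefficients with square sum one\<close>

text \<open>A nonzero integer has square at least 1, so the square sum bounds the size of the
  support, and an empty support would give 0. The one remaining coefficient is 1 or -1. This is
  where integrality of the coefficients enters.\<close>

lemma sum_squares_eq_1_imp_single: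
  fixes u :: "'a \<Rightarrow>\<^sub>0 int"
  assumes "(\<Sum>g\<in>Poly_Mapping.keys u. (Poly_Mapping.lookup u g)\<^sup>2) = 1"
  obtains g where "g \<in> Poly_Mapping.keys u" "u = frag_of g \<or> u = - frag_of g"
proof -
  have "int (card (Poly_Mapping.keys u)) = (\<Sum>g\<in>Poly_Mapping.keys u. 1)"
    by simp
  also have "\<dots> \<le> (\<Sum>g\<in>Poly_Mapping.keys u. (Poly_Mapping.lookup u g)\<^sup>2)"
    by (rule sum_mono) (simp add: in_keys_iff int_one_le_iff_zero_less)
  finally have "card (Poly_Mapping.keys u) \<le> 1"
    using assms by simp
  moreover have "card (Poly_Mapping.keys u) \<noteq> 0"
    using assms by auto
  ultimately have "card (Poly_Mapping.keys u) = 1"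
    by linarith
  then obtain g where g: "Poly_Mapping.keys u = {g}"
    by (rule card_1_singletonE)
  have "Poly_Mapping.lookup u g = 1 \<or> Poly_Mapping.lookup u g = -1"
    using assms by (simp add: g power2_eq_1_iff)
  moreover have "Poly_Mapping.lookup u h = 0" if "h \<noteq> g" for h
    using that g by (metis in_keys_iff singletonD)
  ultimately have "u = frag_of g \<or> u = - frag_of g"
    by (metis (mono_tags, lifting) lookup_frag_of lookup_uminus neg_equal_0_iff_equal poly_mapping_eqI)
  then show ?thesis
    using that g by blast
qed

section \<open>The augmentation\<close>

text \<open>Collapsing all basis elements to the one generator \<open>frag_of ()\<close> and reading
  off its coefficient yields the sum of the coefficients; in this form additivity is inherited from
  \<open>frag_extend\<close>.\<close>

definition augmentation :: "('a \<Rightarrow>\<^sub>0 int) \<Rightarrow> int"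
  where "augmentation u = Poly_Mapping.lookup (frag_extend (\<lambda>_. frag_of ()) u) ()"

lemma augmentation_0 [simp]: "augmentation 0 = 0"
  by (simp add: augmentation_def)

lemma augmentation_frag_of [simp]: "augmentation (frag_of g) = 1"
  by (simp add: augmentation_def)

lemma augmentation_minus [simp]: "augmentation (- u) = - augmentation u"
  by (simp add: augmentation_def frag_extend_minus)

lemma augmentation_diff [simp]: "augmentation (u - v) = augmentation u - augmentation v"
  by (simp add: augmentation_def frag_extend_diff lookup_minus)

lemma augmentation_star: "augmentation (star G u) = augmentation u"
  \<comment> \<open>\<open>frag_induction\<close> runs relative to a set containing the keys;
    \<open>UNIV\<close> serves because the identity holds on every basis element.\<close>
  using subset_UNIV
  by (induction u rule: frag_induction) (simp_all add: star_def frag_extend_diff)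

text \<open>Both sides are additive in \<open>u\<close> and in \<open>v\<close>, and on a pair of
  basis elements both are 1.\<close>

lemma augmentation_mult:
  "augmentation (u \<otimes>\<^bsub>group_ring G\<^esub> v) = augmentation u * augmentation v"
proof -
  have 1: "augmentation (frag_of g \<otimes>\<^bsub>group_ring G\<^esub> v) = augmentation v" for g
    using subset_UNIV[of "Poly_Mapping.keys v"]
    by (induction v rule: frag_induction) (simp_all add: group_ring_mult_simps)
  show ?thesis
    using subset_UNIV[of "Poly_Mapping.keys u"]
    by (induction u rule: frag_induction) (simp_all add: group_ring_mult_simps 1 left_diff_distrib)
qed

lemma group_ring_mult_minus_minus:
  "(- u) \<otimes>\<^bsub>group_ring G\<^esub> (- v) = u \<otimes>\<^bsub>group_ring G\<^esub> v"
  \<comment> \<open>Distributivity over a difference with minuend 0 gives the sign rule in each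
    factor.\<close>
  using group_ring_mult_diff(1)[where u = 0 and G = G] group_ring_mult_diff(2)[where v = 0 and G = G]
  by (simp add: group_ring_mult_zero)

lemma star_diff: "star G (u - v) = star G u - star G v"
  by (simp add: star_def frag_extend_diff)

definition star_norm :: "('a, 'b) monoid_scheme \<Rightarrow> ('a \<Rightarrow>\<^sub>0 int) \<Rightarrow> ('a \<Rightarrow>\<^sub>0 int)"
  where "star_norm G u = u \<otimes>\<^bsub>group_ring G\<^esub> star G u"

context group
begin

abbreviation ZG :: "('a \<Rightarrow>\<^sub>0 int) ring"
  where "ZG \<equiv> group_ring G"

interpretation R: ring ZG
  by (rule ring_group_ring) (rule is_group)

interpretation K: group "central_units G"
  by (rule group_central_units) (rule is_group)

section \<open>Induction over the group ring and the involution\<close>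

lemma frag_of_closed: "g \<in> carrier G \<Longrightarrow> frag_of g \<in> carrier ZG"
  by (simp add: group_ring_simps(1))

lemma group_ring_diff_closed:
  "u \<in> carrier ZG \<Longrightarrow> v \<in> carrier ZG \<Longrightarrow> u - v \<in> carrier ZG"
  using keys_diff[of u v] by (auto simp: group_ring_simps(1))

text \<open>The group elements generate ZG additively, and closure under differences takes care of
  negatives. Additive and biadditive identities are thereby reduced to group elements.\<close>

lemma group_ring_induct [consumes 1, case_names zero one diff]:
  assumes "u \<in> carrier ZG" "P 0" "\<And>g. g \<in> carrier G \<Longrightarrow> P (frag_of g)"
    and "\<And>u v. P u \<Longrightarrow> P v \<Longrightarrow> P (u - v)"
  shows "P u"
  using assms by (auto simp: group_ring_simps(1) intro: frag_induction)

lemma star_closed: "u \<in> carrier ZG \<Longrightarrow> star G u \<in> carrier ZG"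
  by (fastforce simp: group_ring_simps(1) star_def dest!: subsetD[OF keys_frag_extend])

lemma star_star: "u \<in> carrier ZG \<Longrightarrow> star G (star G u) = u"
  by (induction u rule: group_ring_induct) (simp_all add: star_def frag_extend_diff)

lemma star_one: "star G \<one>\<^bsub>ZG\<^esub> = \<one>\<^bsub>ZG\<^esub>"
  by (simp add: star_def group_ring_simps(3))

text \<open>By biadditivity this comes down to the rule for the inverse of a product of two group
  elements.\<close>

lemma star_mult:
  assumes "u \<in> carrier ZG" and v: "v \<in> carrier ZG"
  shows "star G (u \<otimes>\<^bsub>ZG\<^esub> v) = star G v \<otimes>\<^bsub>ZG\<^esub> star G u"
proof -
  have 1: "star G (frag_of g \<otimes>\<^bsub>ZG\<^esub> v) = star G v \<otimes>\<^bsub>ZG\<^esub> star G (frag_of g)"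
    if "g \<in> carrier G" for g
    using v
  proof (induction v rule: group_ring_induct)
    case (one h)
    then show ?case
      using that by (simp add: star_def group_ring_mult_frag_of inv_mult_group)
  qed (simp_all add: star_diff group_ring_mult_simps, simp add: star_def group_ring_mult_zero)
  show ?thesis
    using assms(1)
  proof (induction u rule: group_ring_induct)
    case (one g)
    then show ?case by (rule 1)
  qed (simp_all add: star_diff group_ring_mult_simps, simp add: star_def group_ring_mult_zero)
qed

section \<open>The coefficient at the identity\<close>

text \<open>A product of group elements \<open>g\<close> and \<open>h\<close> is the identity
  exactly when \<open>h\<close> is \<open>inv g\<close>. Both sides are additive in
  \<open>v\<close>, so \<open>v\<close> may be taken to be a single group element.\<close>

lemma lookup_mult_one:
  assumes "u \<in> carrier ZG" "v \<in> carrier ZG"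
  shows "Poly_Mapping.lookup (u \<otimes>\<^bsub>ZG\<^esub> v) \<one> =
    (\<Sum>g\<in>Poly_Mapping.keys u. Poly_Mapping.lookup u g * Poly_Mapping.lookup v (inv g))"
  using assms(2)
proof (induction v rule: group_ring_induct)
  case zero
  then show ?case by (simp add: group_ring_mult_zero)
next
  case (one h)
  have "\<one> = g \<otimes> h \<longleftrightarrow> inv g = h" if "g \<in> Poly_Mapping.keys u" for g
    using that one assms(1)
    by (metis group_ring_simps(1) inv_equality inv_inv subsetD r_inv)
  then show ?case
    by (simp add: lookup_group_ring_mult) (auto intro!: sum.cong)
next
  case (diff v w)
  then show ?case
    by (simp add: group_ring_mult_diff lookup_minus right_diff_distrib sum_subtractf)
qed

text \<open>The coefficient of \<open>star G u\<close> at \<open>inv g\<close> is that of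
  \<open>u\<close> at \<open>g\<close>, which turns each summand of \<open>lookup_mult_one\<close>
  into a square.\<close>

lemma lookup_star_norm_one:
  assumes "u \<in> carrier ZG"
  shows "Poly_Mapping.lookup (star_norm G u) \<one> =
    (\<Sum>g\<in>Poly_Mapping.keys u. (Poly_Mapping.lookup u g)\<^sup>2)"
proof -
  have u: "Poly_Mapping.keys u \<subseteq> carrier G"
    using assms by (simp add: group_ring_simps(1))
  show ?thesis
    unfolding star_norm_def lookup_mult_one[OF assms star_closed[OF assms]]
  proof (rule sum.cong[OF refl])
    fix g assume "g \<in> Poly_Mapping.keys u"
    then have "g \<in> carrier G" using u by blast
    then show "Poly_Mapping.lookup u g * Poly_Mapping.lookup (star G u) (inv g) =
        (Poly_Mapping.lookup u g)\<^sup>2"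
      using lookup_star[OF is_group u, of "inv g"] by (simp add: power2_eq_square)
  qed
qed

lemma lookup_star_norm_one_nonneg:
  "u \<in> carrier ZG \<Longrightarrow> 0 \<le> Poly_Mapping.lookup (star_norm G u) \<one>"
  by (simp add: lookup_star_norm_one sum_nonneg)

text \<open>Positive definiteness: a vanishing sum of squares has only zero terms, while
  coefficients on the support are nonzero.\<close>

lemma lookup_star_norm_one_eq_0:
  assumes "u \<in> carrier ZG" "Poly_Mapping.lookup (star_norm G u) \<one> = 0"
  shows "u = 0"
proof -
  have "\<forall>g\<in>Poly_Mapping.keys u. (Poly_Mapping.lookup u g)\<^sup>2 = 0"
    using assms by (simp add: lookup_star_norm_one sum_nonneg_eq_0_iff)
  then show ?thesis
    by (metis keys_eq_empty equals0I in_keys_iff power2_eq_iff_nonneg zero_eq_power2)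
qed

section \<open>The center of the group ring\<close>

lemma center_group_ringD:
  "u \<in> center ZG \<Longrightarrow> u \<in> carrier ZG"
  "u \<in> center ZG \<Longrightarrow> v \<in> carrier ZG \<Longrightarrow> u \<otimes>\<^bsub>ZG\<^esub> v = v \<otimes>\<^bsub>ZG\<^esub> u"
  by (simp_all add: center_def)

text \<open>Both products are additive in the second element, and group elements generate ZG
  additively.\<close>

lemma center_group_ringI:
  assumes u: "u \<in> carrier ZG"
    and comm: "\<And>g. g \<in> carrier G \<Longrightarrow> u \<otimes>\<^bsub>ZG\<^esub> frag_of g = frag_of g \<otimes>\<^bsub>ZG\<^esub> u"
  shows "u \<in> center ZG"
proof -
  have "u \<otimes>\<^bsub>ZG\<^esub> v = v \<otimes>\<^bsub>ZG\<^esub> u" if "v \<in> carrier ZG" for v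
    using that by (induction v rule: group_ring_induct) (simp_all add: group_ring_mult_simps comm)
  then show ?thesis
    using u by (simp add: center_def)
qed

lemma frag_of_mem_center_iff:
  "frag_of g \<in> center ZG \<longleftrightarrow> g \<in> center G"
proof
  assume "frag_of g \<in> center ZG"
  then show "g \<in> center G"
    by (auto simp: center_def group_ring_simps(1) group_ring_mult_frag_of frag_of_eq
        dest!: bspec[of _ _ "frag_of _"])
next
  assume "g \<in> center G"
  then show "frag_of g \<in> center ZG"
    by (intro center_group_ringI) (auto simp: center_def frag_of_closed group_ring_mult_frag_of)
qed

lemma center_group_ring_diff:
  "u \<in> center ZG \<Longrightarrow> v \<in> center ZG \<Longrightarrow> u - v \<in> center ZG"
  by (simp add: center_def group_ring_diff_closed group_ring_mult_diff)

lemma center_group_ring_minus: "u \<in> center ZG \<Longrightarrow> - u \<in> center ZG"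
  using center_group_ring_diff[of 0 u] by (simp add: center_def group_ring_simps(1) group_ring_mult_zero)

lemma center_group_ring_mult:
  assumes u: "u \<in> center ZG" and v: "v \<in> center ZG"
  shows "u \<otimes>\<^bsub>ZG\<^esub> v \<in> center ZG"
proof -
  have c: "u \<in> carrier ZG" "v \<in> carrier ZG"
    using u v by (simp_all add: center_group_ringD(1))
  have "u \<otimes>\<^bsub>ZG\<^esub> v \<otimes>\<^bsub>ZG\<^esub> w = w \<otimes>\<^bsub>ZG\<^esub> (u \<otimes>\<^bsub>ZG\<^esub> v)" if w: "w \<in> carrier ZG" for w
  proof -
    have "u \<otimes>\<^bsub>ZG\<^esub> v \<otimes>\<^bsub>ZG\<^esub> w = u \<otimes>\<^bsub>ZG\<^esub> (w \<otimes>\<^bsub>ZG\<^esub> v)"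
      using c w center_group_ringD(2)[OF v w] by (simp add: R.m_assoc)
    also have "\<dots> = u \<otimes>\<^bsub>ZG\<^esub> w \<otimes>\<^bsub>ZG\<^esub> v"
      using c w by (simp add: R.m_assoc)
    also have "u \<otimes>\<^bsub>ZG\<^esub> w = w \<otimes>\<^bsub>ZG\<^esub> u"
      using u w by (rule center_group_ringD(2))
    finally show ?thesis
      using c w by (simp add: R.m_assoc)
  qed
  then show ?thesis
    using c by (simp add: center_def)
qed

text \<open>Applying the involution to the relation that \<open>u\<close> commutes with
  \<open>star G v\<close> reverses the products and gives that \<open>star G u\<close> commutes with
  \<open>v\<close>.\<close>

lemma center_group_ring_star:
  assumes "u \<in> center ZG"
  shows "star G u \<in> center ZG"
proof -
  have u: "u \<in> carrier ZG" using assms by (rule center_group_ringD)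
  have "star G u \<otimes>\<^bsub>ZG\<^esub> v = v \<otimes>\<^bsub>ZG\<^esub> star G u" if v: "v \<in> carrier ZG" for v
  proof -
    have "star G (star G v \<otimes>\<^bsub>ZG\<^esub> u) = star G (u \<otimes>\<^bsub>ZG\<^esub> star G v)"
      using center_group_ringD(2)[OF assms star_closed[OF v]] by simp
    then show ?thesis
      by (simp add: star_mult star_closed star_star u v)
  qed
  then show ?thesis
    using star_closed[OF u] by (simp add: center_def)
qed

section \<open>Units and central units\<close>

lemma group_ring_UnitsI:
  assumes "u \<in> carrier ZG" "v \<in> carrier ZG" "v \<otimes>\<^bsub>ZG\<^esub> u = \<one>\<^bsub>ZG\<^esub>" "u \<otimes>\<^bsub>ZG\<^esub> v = \<one>\<^bsub>ZG\<^esub>"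
  shows "u \<in> Units ZG"
  using assms by (auto simp: Units_def)

lemma frag_of_Units:
  assumes "g \<in> carrier G"
  shows "frag_of g \<in> Units ZG"
proof (rule group_ring_UnitsI)
  show "frag_of (inv g) \<otimes>\<^bsub>ZG\<^esub> frag_of g = \<one>\<^bsub>ZG\<^esub>" "frag_of g \<otimes>\<^bsub>ZG\<^esub> frag_of (inv g) = \<one>\<^bsub>ZG\<^esub>"
    using assms by (simp_all add: group_ring_mult_frag_of group_ring_simps(3))
qed (use assms in \<open>simp_all add: frag_of_closed\<close>)

lemma uminus_Units:
  assumes "u \<in> Units ZG"
  shows "- u \<in> Units ZG"
proof -
  have "- v \<in> carrier ZG" if "v \<in> carrier ZG" for v :: "'a \<Rightarrow>\<^sub>0 int"
    using that by (simp add: group_ring_simps(1))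
  then show ?thesis
    using assms
    by (intro group_ring_UnitsI[where v = "- (inv\<^bsub>ZG\<^esub> u)"])
      (simp_all add: group_ring_mult_minus_minus R.Units_closed)
qed

text \<open>Group elements are units, so an element of the center of the unit group commutes with
  all of them and therefore with all of ZG.\<close>

lemma carrier_central_units: "carrier (central_units G) = Units ZG \<inter> center ZG"
proof (intro equalityI subsetI)
  fix u assume u: "u \<in> carrier (central_units G)"
  then have U: "u \<in> Units ZG"
    by (simp add: central_units_def center_def units_of_def)
  moreover have "u \<in> center ZG"
    using u U by (intro center_group_ringI)
      (auto simp: central_units_def center_def units_of_def frag_of_Units R.Units_closed)
  ultimately show "u \<in> Units ZG \<inter> center ZG" by blast
qed (auto simp: central_units_def center_def units_of_def R.Units_closed)

lemma central_units_simps: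
  "x \<otimes>\<^bsub>central_units G\<^esub> y = x \<otimes>\<^bsub>ZG\<^esub> y" "\<one>\<^bsub>central_units G\<^esub> = \<one>\<^bsub>ZG\<^esub>"
  by (simp_all add: central_units_def units_of_def)

lemma inv_central_units:
  assumes "u \<in> carrier (central_units G)"
  shows "inv\<^bsub>central_units G\<^esub> u = inv\<^bsub>ZG\<^esub> u"
  using assms K.inv_closed[OF assms] K.l_inv[OF assms] R.inv_unique' K.r_inv[OF assms]
  by (simp add: carrier_central_units central_units_simps R.Units_closed)

lemma trivial_central_units_subset: "trivial_central_units G \<subseteq> carrier (central_units G)"
proof -
  have "frag_of g \<in> Units ZG \<inter> center ZG" if "g \<in> center G" for g
    using that frag_of_mem_center_iff[of g] frag_of_Units[of g] by (auto simp: center_def)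
  then show ?thesis
    unfolding trivial_central_units_def carrier_central_units
    by (auto simp: uminus_Units center_group_ring_minus)
qed

lemma star_mem_central_units:
  assumes "u \<in> carrier (central_units G)"
  shows "star G u \<in> carrier (central_units G)"
proof -
  have u: "u \<in> Units ZG" "u \<in> center ZG"
    using assms by (simp_all add: carrier_central_units)
  have "star G u \<in> Units ZG"
  proof (rule group_ring_UnitsI)
    \<comment> \<open>The involution carries the inverse of \<open>u\<close> to the inverse of
      \<open>star G u\<close>.\<close>
    show "star G (inv\<^bsub>ZG\<^esub> u) \<otimes>\<^bsub>ZG\<^esub> star G u = \<one>\<^bsub>ZG\<^esub>" "star G u \<otimes>\<^bsub>ZG\<^esub> star G (inv\<^bsub>ZG\<^esub> u) = \<one>\<^bsub>ZG\<^esub>"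
      using u by (simp_all add: R.Units_closed star_one flip: star_mult)
  qed (use u in \<open>simp_all add: star_closed R.Units_closed\<close>)
  then show ?thesis
    using center_group_ring_star[OF u(2)] by (simp add: carrier_central_units)
qed

section \<open>The norm on central units, its kernel and its torsion\<close>

lemma star_norm_mem_central_units:
  "u \<in> carrier (central_units G) \<Longrightarrow> star_norm G u \<in> carrier (central_units G)"
  using K.m_closed[OF _ star_mem_central_units]
  by (simp add: star_norm_def central_units_simps)

lemma star_star_norm: "u \<in> carrier ZG \<Longrightarrow> star G (star_norm G u) = star_norm G u"
  by (simp add: star_norm_def star_mult star_closed star_star)

lemma star_norm_closed: "u \<in> carrier ZG \<Longrightarrow> star_norm G u \<in> carrier ZG"
  by (simp add: star_norm_def star_closed)

text \<open>The involution reverses \<open>u\<close> and \<open>v\<close>, and the central element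
  \<open>star G u\<close> then moves back past the norm of \<open>v\<close>. Since \<open>v\<close>
  ranges over all of ZG, powers of a unit can be inserted for it directly.\<close>

lemma star_norm_mult:
  assumes "u \<in> center ZG" and v: "v \<in> carrier ZG"
  shows "star_norm G (u \<otimes>\<^bsub>ZG\<^esub> v) = star_norm G u \<otimes>\<^bsub>ZG\<^esub> star_norm G v"
proof -
  have u: "u \<in> carrier ZG" using assms(1) by (rule center_group_ringD)
  have "star_norm G (u \<otimes>\<^bsub>ZG\<^esub> v) = u \<otimes>\<^bsub>ZG\<^esub> (star_norm G v \<otimes>\<^bsub>ZG\<^esub> star G u)"
    by (simp add: star_norm_def star_mult star_closed u v R.m_assoc)
  also have "star_norm G v \<otimes>\<^bsub>ZG\<^esub> star G u = star G u \<otimes>\<^bsub>ZG\<^esub> star_norm G v"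
    using center_group_ringD(2)[OF center_group_ring_star[OF assms(1)] star_norm_closed[OF v]] by simp
  finally show ?thesis
    by (simp add: star_norm_def star_closed u v R.m_assoc)
qed

lemma star_norm_one: "star_norm G \<one>\<^bsub>ZG\<^esub> = \<one>\<^bsub>ZG\<^esub>"
  by (simp add: star_norm_def star_one)

lemma star_norm_hom: "star_norm G \<in> hom (central_units G) (central_units G)"
  by (rule homI)
    (simp_all add: star_norm_mem_central_units, simp add: central_units_simps carrier_central_units
      star_norm_mult R.Units_closed)

interpretation N: group_hom "central_units G" "central_units G" "star_norm G"
  using K.is_group star_norm_hom by (simp add: group_hom_def group_hom_axioms_def)

lemma kernel_star_norm:
  "kernel (central_units G) (central_units G) (star_norm G) = trivial_central_units G"
proof (intro equalityI subsetI)
  fix u assume "u \<in> kernel (central_units G) (central_units G) (star_norm G)"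
  then have u: "u \<in> Units ZG" "u \<in> center ZG" and N: "star_norm G u = \<one>\<^bsub>ZG\<^esub>"
    by (auto simp: kernel_def carrier_central_units central_units_simps)
  have "(\<Sum>g\<in>Poly_Mapping.keys u. (Poly_Mapping.lookup u g)\<^sup>2) = 1"
    using lookup_star_norm_one[of u] u by (simp add: N group_ring_simps(3) R.Units_closed)
  then obtain g where "g \<in> Poly_Mapping.keys u" and g: "u = frag_of g \<or> u = - frag_of g"
    by (rule sum_squares_eq_1_imp_single)
  \<comment> \<open>The element \<open>frag_of g\<close> is \<open>u\<close> or \<open>- u\<close>,
    so it inherits centrality from \<open>u\<close>.\<close>
  moreover have "frag_of g \<in> center ZG"
    using g u(2) center_group_ring_minus[OF u(2)] by auto
  ultimately show "u \<in> trivial_central_units G"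
    by (auto simp: frag_of_mem_center_iff trivial_central_units_def)
next
  fix u assume u: "u \<in> trivial_central_units G"
  have "star_norm G (frag_of g) = \<one>\<^bsub>ZG\<^esub>" if "g \<in> center G" for g
    using that by (simp add: star_norm_def star_def group_ring_mult_frag_of group_ring_simps(3) center_def)
  moreover have "star_norm G (- v) = star_norm G v" for v
    by (simp add: star_norm_def star_def frag_extend_minus group_ring_mult_minus_minus)
  ultimately have "star_norm G u = \<one>\<^bsub>ZG\<^esub>"
    using u by (auto simp: trivial_central_units_def)
  then show "u \<in> kernel (central_units G) (central_units G) (star_norm G)"
    using u trivial_central_units_subset by (auto simp: kernel_def central_units_simps)
qed

text \<open>
  With \<open>s = u u\<^sup>*\<close> and \<open>d = s - 1\<close>, the coefficient of \<open>(d u\<^sup>k) (d u\<^sup>k)\<^sup>* = s\<^sup>k d\<^sup>2 = (s\<^sup>k\<^sup>+\<^sup>1 - s\<^sup>k) d\<close>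
  at the identity is nonnegative, and these telescope to \<open>0\<close> over a period of \<open>s\<close>.
\<close>

lemma star_norm_torsion:
  assumes u: "u \<in> center ZG" and n: "n > (0::nat)"
    and s: "star_norm G u [^]\<^bsub>ZG\<^esub> n = \<one>\<^bsub>ZG\<^esub>"
  shows "star_norm G u = \<one>\<^bsub>ZG\<^esub>"
proof -
  let ?s = "star_norm G u"
  define d where "d = ?s - \<one>\<^bsub>ZG\<^esub>"
  define t where "t k = Poly_Mapping.lookup (?s [^]\<^bsub>ZG\<^esub> k \<otimes>\<^bsub>ZG\<^esub> d) \<one>" for k :: nat
  have uc: "u \<in> carrier ZG" using u by (rule center_group_ringD)
  have sc: "?s \<in> carrier ZG" using uc by (rule star_norm_closed)
  have one_center: "\<one>\<^bsub>ZG\<^esub> \<in> center ZG" by (simp add: center_def)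
  have "?s \<in> center ZG"
    unfolding star_norm_def using u center_group_ring_star[OF u] by (rule center_group_ring_mult)
  then have d: "d \<in> center ZG"
    unfolding d_def using one_center by (rule center_group_ring_diff)
  then have dc: "d \<in> carrier ZG" by (rule center_group_ringD)
  \<comment> \<open>Both \<open>?s\<close> and the identity are symmetric; hence the norm of
    \<open>d\<close> is the square of \<open>d\<close>.\<close>
  have sd: "star G d = d"
    by (simp add: d_def star_diff star_star_norm uc star_one)
  have pow: "star_norm G (u [^]\<^bsub>ZG\<^esub> k) = ?s [^]\<^bsub>ZG\<^esub> k" for k :: nat
  proof (induction k)
    case (Suc k)
    have "star_norm G (u [^]\<^bsub>ZG\<^esub> Suc k) = star_norm G (u \<otimes>\<^bsub>ZG\<^esub> u [^]\<^bsub>ZG\<^esub> k)"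
      using R.nat_pow_Suc2[OF uc, of k] by (rule arg_cong)
    also have "\<dots> = ?s \<otimes>\<^bsub>ZG\<^esub> ?s [^]\<^bsub>ZG\<^esub> k"
      using u uc by (simp add: star_norm_mult Suc)
    also have "\<dots> = ?s [^]\<^bsub>ZG\<^esub> Suc k"
      using R.nat_pow_Suc2[OF sc, of k] by (rule sym)
    finally show ?case .
  qed (simp add: star_norm_one)
  have norm: "Poly_Mapping.lookup (star_norm G (d \<otimes>\<^bsub>ZG\<^esub> u [^]\<^bsub>ZG\<^esub> k)) \<one> = t (Suc k) - t k" for k
  proof -
    let ?p = "?s [^]\<^bsub>ZG\<^esub> k"
    have p: "?p \<in> carrier ZG" using sc by simp
    have "star_norm G (d \<otimes>\<^bsub>ZG\<^esub> u [^]\<^bsub>ZG\<^esub> k) = d \<otimes>\<^bsub>ZG\<^esub> d \<otimes>\<^bsub>ZG\<^esub> ?p"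
      using d uc by (simp add: star_norm_mult pow) (simp add: star_norm_def sd)
    also have "\<dots> = ?p \<otimes>\<^bsub>ZG\<^esub> d \<otimes>\<^bsub>ZG\<^esub> d"
      using center_group_ringD(2)[OF d p] dc p by (simp add: R.m_assoc) (simp flip: R.m_assoc)
    also have "?p \<otimes>\<^bsub>ZG\<^esub> d = ?s [^]\<^bsub>ZG\<^esub> Suc k - ?p"
      using p by (simp add: d_def group_ring_mult_diff)
    finally show ?thesis
      by (simp add: t_def group_ring_mult_diff lookup_minus)
  qed
  have "(\<Sum>k<n. Poly_Mapping.lookup (star_norm G (d \<otimes>\<^bsub>ZG\<^esub> u [^]\<^bsub>ZG\<^esub> k)) \<one>) = t n - t 0"
    unfolding norm by (rule sum_lessThan_telescope)
  also have "\<dots> = 0"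
    by (simp add: t_def s)
  finally have "\<forall>k\<in>{..<n}. Poly_Mapping.lookup (star_norm G (d \<otimes>\<^bsub>ZG\<^esub> u [^]\<^bsub>ZG\<^esub> k)) \<one> = 0"
    using dc uc by (subst (asm) sum_nonneg_eq_0_iff) (simp_all add: lookup_star_norm_one_nonneg)
  \<comment> \<open>Since \<open>n\<close> is positive, the sum contains the term
    \<open>k = 0\<close>, which belongs to \<open>d\<close> itself.\<close>
  then have "Poly_Mapping.lookup (star_norm G d) \<one> = 0"
    using n dc by (auto dest: bspec[of _ _ 0])
  then have "d = 0"
    using dc by (intro lookup_star_norm_one_eq_0)
  then show ?thesis
    by (simp add: d_def)
qed

section \<open>Comparing a central unit with its image under the involution\<close>

text \<open>As \<open>u\<close> commutes with \<open>star G u\<close>, both have the same norm.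
  Their quotient \<open>v\<close> therefore has norm 1 and lies in the kernel.\<close>

lemma central_unit_eq_mult_star:
  assumes K: "u \<in> carrier (central_units G)"
  obtains g where "g \<in> center G" "u = frag_of g \<otimes>\<^bsub>ZG\<^esub> star G u"
proof -
  have u: "u \<in> Units ZG" "u \<in> center ZG"
    using K by (simp_all add: carrier_central_units)
  then have uc: "u \<in> carrier ZG" by (simp add: R.Units_closed)
  define w where "w = star G u"
  have w: "w \<in> carrier (central_units G)"
    unfolding w_def using K by (rule star_mem_central_units)
  then have wU: "w \<in> Units ZG" and wc: "w \<in> carrier ZG"
    by (simp_all add: carrier_central_units R.Units_closed)
  have iK: "inv\<^bsub>central_units G\<^esub> w \<in> carrier (central_units G)"
    using w by simp
  define v where "v = u \<otimes>\<^bsub>ZG\<^esub> inv\<^bsub>ZG\<^esub> w"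
  \<comment> \<open>Writing \<open>v\<close> inside the group of central units makes the
    homomorphism property of the norm available for the quotient.\<close>
  have vK: "v = u \<otimes>\<^bsub>central_units G\<^esub> inv\<^bsub>central_units G\<^esub> w"
    using w by (simp add: v_def central_units_simps inv_central_units)
  have v: "v \<in> carrier (central_units G)"
    unfolding vK using K iK by simp
  have "star_norm G w = star_norm G u"
    using center_group_ringD(2)[OF u(2) wc] uc by (simp add: star_norm_def w_def star_star)
  then have "star_norm G v = \<one>\<^bsub>central_units G\<^esub>"
    unfolding vK using K w by (simp add: N.hom_mult)
  then have "v \<in> trivial_central_units G"
    using v by (simp add: kernel_def flip: kernel_star_norm)
  then obtain g where g: "g \<in> center G" "v = frag_of g \<or> v = - frag_of g"
    by (auto simp: trivial_central_units_def)
  have vw: "u = v \<otimes>\<^bsub>ZG\<^esub> w"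
    using uc wU wc by (simp add: v_def R.m_assoc)
  \<comment> \<open>The augmentation of a unit divides 1 and so can be cancelled. Since
    \<open>u\<close> and \<open>star G u\<close> have the same augmentation, that of
    \<open>v\<close> is 1, whereas \<open>- frag_of g\<close> has -1.\<close>
  have "augmentation (u \<otimes>\<^bsub>ZG\<^esub> inv\<^bsub>ZG\<^esub> u) = 1"
    using u by (simp add: group_ring_simps(3))
  then have "augmentation u \<noteq> 0"
    by (auto simp: augmentation_mult)
  moreover have "augmentation u = augmentation v * augmentation u"
    using arg_cong[OF vw, of augmentation] by (simp add: augmentation_mult w_def augmentation_star)
  ultimately have "v = frag_of g"
    using g(2) by auto
  then show ?thesis
    using that[OF g(1)] vw unfolding w_def by blast
qed

lemma central_unit_square:
  assumes K: "u \<in> carrier (central_units G)"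
  shows "u [^]\<^bsub>ZG\<^esub> (2::nat) \<in>
    (frag_of ` center G) <#>\<^bsub>ZG\<^esub> (star_norm G ` carrier (central_units G))"
proof -
  have u: "u \<in> carrier ZG" "u \<in> center ZG"
    using K by (simp_all add: carrier_central_units R.Units_closed)
  obtain g where g: "g \<in> center G" "u = frag_of g \<otimes>\<^bsub>ZG\<^esub> star G u"
    using K by (rule central_unit_eq_mult_star)
  then have gc: "frag_of g \<in> carrier ZG"
    by (simp add: center_def frag_of_closed)
  have "u [^]\<^bsub>ZG\<^esub> (2::nat) = u \<otimes>\<^bsub>ZG\<^esub> u"
    using u by (simp add: numeral_2_eq_2)
  \<comment> \<open>Only the left factor is replaced: the equation for \<open>u\<close> has
    \<open>u\<close> on both sides.\<close>
  also have "\<dots> = (frag_of g \<otimes>\<^bsub>ZG\<^esub> star G u) \<otimes>\<^bsub>ZG\<^esub> u"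
    using g(2) by (rule arg_cong)
  also have "\<dots> = frag_of g \<otimes>\<^bsub>ZG\<^esub> star_norm G u"
    using gc u center_group_ringD(2)[OF u(2) star_closed[OF u(1)]]
    by (simp add: star_norm_def R.m_assoc star_closed)
  finally show ?thesis
    using g(1) K by (auto simp: set_mult_def)
qed

section \<open>Trivial norms, the exact sequence and the theorem\<close>

text \<open>For nonzero \<open>u\<close> the norm has a positive coefficient at the identity. Among
  the elements \<open>frag_of g\<close> and \<open>- frag_of g\<close>, only the ring identity has
  one.\<close>

lemma star_norm_eq_1_if_trivial:
  assumes "u \<in> carrier ZG" "star_norm G u \<in> trivial_central_units G"
  shows "star_norm G u = \<one>\<^bsub>ZG\<^esub> \<or> u = 0"
proof (rule disjCI)
  assume "u \<noteq> 0"
  then have "Poly_Mapping.lookup (star_norm G u) \<one> > 0"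
    using lookup_star_norm_one_nonneg[OF assms(1)] lookup_star_norm_one_eq_0[OF assms(1)] by fastforce
  then show "star_norm G u = \<one>\<^bsub>ZG\<^esub>"
    using assms(2) by (auto simp: trivial_central_units_def group_ring_simps(3) split: if_splits)
qed

text \<open>The groups are listed against the direction of the maps, with the quotient first. The
  norm is onto because the quotient is its image, and exactness in the middle is
  \<open>kernel_star_norm\<close>.\<close>

lemma short_exact_sequence_star_norm:
  "short_exact_sequence
     (central_units G\<lparr>carrier := star_norm G ` carrier (central_units G)\<rparr>)
     (central_units G)
     (central_units G\<lparr>carrier := trivial_central_units G\<rparr>)
     (star_norm G) (\<lambda>u. u)"
proof -
  let ?S = "central_units G\<lparr>carrier := star_norm G ` carrier (central_units G)\<rparr>"
  let ?T = "central_units G\<lparr>carrier := trivial_central_units G\<rparr>"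
  have S: "group ?S"
    using N.img_is_subgroup by (rule subgroup.subgroup_is_group) (rule K.is_group)
  have T: "group ?T"
    using N.subgroup_kernel unfolding kernel_star_norm
    by (rule subgroup.subgroup_is_group) (rule K.is_group)
  have hS: "star_norm G \<in> hom (central_units G) ?S"
    using star_norm_hom by (auto simp: hom_def)
  have hT: "(\<lambda>u. u) \<in> hom ?T (central_units G)"
    using trivial_central_units_subset by (auto simp: hom_def)
  have ker: "kernel (central_units G) ?S (star_norm G) = trivial_central_units G"
    by (simp add: kernel_def flip: kernel_star_norm)
  show ?thesis
    unfolding short_exact_sequence_iff
    using S T hS hT ker K.is_group
    by (simp add: group_hom_def group_hom_axioms_def epi_def mon_def)
qed

lemma torsion_free_star_norm_image:
  "torsion_free (central_units G\<lparr>carrier := star_norm G ` carrier (central_units G)\<rparr>)"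
proof -
  \<comment> \<open>Restricting the carrier changes neither product nor identity, so powers may be
    computed in ZG, where \<open>star_norm_torsion\<close> applies.\<close>
  have pow: "x [^]\<^bsub>central_units G\<lparr>carrier := H\<rparr>\<^esub> n = x [^]\<^bsub>ZG\<^esub> n" for x H and n :: nat
    by (simp add: nat_pow_def central_units_simps)
  show ?thesis
    unfolding torsion_free_def pow
    using star_norm_torsion by (auto simp: central_units_simps carrier_central_units)
qed

end

theorem theorem13:
  fixes G :: "('a, 'b) monoid_scheme"
  assumes "group G"
  shows "(\<exists>S. subgroup S (central_units G) \<and>
              torsion_free (central_units G\<lparr>carrier := S\<rparr>) \<and>
              (\<forall>u\<in>S. symmetric G u) \<and>
              (\<exists>\<phi>. short_exact_sequence
                     (central_units G\<lparr>carrier := S\<rparr>)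
                     (central_units G)
                     (central_units G\<lparr>carrier := trivial_central_units G\<rparr>)
                     \<phi> (\<lambda>u. u)) \<and>
              (\<forall>u\<in>carrier (central_units G).
                 (\<exists>g\<in>center G. u = frag_of g \<otimes>\<^bsub>group_ring G\<^esub> star G u) \<and>
                 u [^]\<^bsub>group_ring G\<^esub> (2::nat) \<in> (frag_of ` center G) <#>\<^bsub>group_ring G\<^esub> S)) \<and>
         ((\<forall>u\<in>carrier (central_units G). symmetric G u \<longrightarrow> u \<in> trivial_central_units G) \<longrightarrow>
           (\<forall>u\<in>carrier (central_units G). u \<in> trivial_central_units G) \<and> cut_group G)"
proof -
  interpret group G by fact
  interpret K: group "central_units G" by (rule group_central_units) fact
  interpret N: group_hom "central_units G" "central_units G" "star_norm G"
    using K.is_group star_norm_hom by (simp add: group_hom_def group_hom_axioms_def)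
  interpret R: ring ZG by (rule ring_group_ring) fact
  let ?S = "star_norm G ` carrier (central_units G)"
  have closed: "u \<in> carrier ZG" if "u \<in> carrier (central_units G)" for u
    using that by (simp add: carrier_central_units R.Units_closed)
  have sym: "symmetric G s" if "s \<in> ?S" for s
    using that closed by (auto simp: symmetric_def star_star_norm)
  \<comment> \<open>The norm of \<open>u\<close> is a symmetric central unit, hence trivial by
    assumption. A trivial norm of a unit equals 1, which puts \<open>u\<close> into the
    kernel.\<close>
  have trivial: "u \<in> trivial_central_units G"
    if triv: "\<forall>u\<in>carrier (central_units G). symmetric G u \<longrightarrow> u \<in> trivial_central_units G"
      and u: "u \<in> carrier (central_units G)" for u
  proof -
    have "star_norm G u \<in> trivial_central_units G"
      using triv u sym star_norm_mem_central_units by blast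
    then have "star_norm G u = \<one>\<^bsub>ZG\<^esub> \<or> u = 0"
      by (rule star_norm_eq_1_if_trivial[OF closed[OF u]])
    moreover have "u \<noteq> 0"
    proof
      assume "u = 0"
      then have "\<one>\<^bsub>ZG\<^esub> = (0 :: 'a \<Rightarrow>\<^sub>0 int)"
        using K.l_inv[OF u] by (simp add: central_units_simps group_ring_mult_zero)
      then show False by (simp add: group_ring_simps(3))
    qed
    ultimately show ?thesis
      using u by (simp add: kernel_def central_units_simps flip: kernel_star_norm)
  qed
  have "carrier (central_units G) = center (units_of ZG)"
    by (simp add: central_units_def)
  then have cut: "cut_group G"
    if "\<forall>u\<in>carrier (central_units G). u \<in> trivial_central_units G"
    using that trivial_central_units_subset assms by (auto simp: cut_group_def)
  show ?thesis
  proof (intro conjI impI exI[of _ ?S] exI[of _ "star_norm G"] ballI)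
    show "subgroup ?S (central_units G)" by (rule N.img_is_subgroup)
    show "torsion_free (central_units G\<lparr>carrier := ?S\<rparr>)" by (rule torsion_free_star_norm_image)
  next
    fix u assume u: "u \<in> carrier (central_units G)"
    show "\<exists>g\<in>center G. u = frag_of g \<otimes>\<^bsub>ZG\<^esub> star G u"
      using central_unit_eq_mult_star[OF u] by blast
    show "u [^]\<^bsub>ZG\<^esub> (2::nat) \<in> (frag_of ` center G) <#>\<^bsub>ZG\<^esub> ?S"
      using u by (rule central_unit_square)
  qed (use sym trivial cut short_exact_sequence_star_norm in auto)
qed

end
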